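(* Let $U$ be an up rule on an $I$-graded poset $\Omega$ with finite level sets $\Omega_i$. Then there exists a maximal $U$-sequence, i.e. a $U$-sequence $(\pi_i)_{i\in I}$ with index interval $I$. Moreover, there exists a positive maximal $U$-sequence (one with $\pi_i(u)>0$ for every $i\in I$ and $u\in\Omega_i$) if and only if there is a sequence $(b_i\colon\Omega_i\to(0,\infty))_{i\in I}$ with the property that for any $m\le n$ in $I$ there is a distribution $\pi_{m,n}\in M(\Omega_m)$ such that $U^{n-m}\pi_{m,n}\ge b_n$ (pointwise on $\Omega_n$).
   Context: Let $I\subseteq\mathbb{Z}$ be a (possibly infinite) nonempty interval of integers. An $I$-graded poset $\Omega$ is a countable (or finite) poset with a surjective map $\rho\colon\Omega\to I$ (the rank function) such that $u<v$ implies $\rho(u)<\rho(v)$, and $u\lessdot v$ implies $\rho(v)=\rho(u)+1$. Here $u\lessdot v$ means that $v$ covers $u$. The level sets are $\Omega_i=\rho^{-1}(i)$. An up rule on $\Omega$ is an assignment of a probability $U(u\rightarrow v)\in[0,1]$ to each pair $(u,v)\in\Omega\times\Omega$ such that $U(u\rightarrow v)>0\Leftrightarrow u\lessdot v$, and $\sum_{v\in\Omega}U(u\rightarrow v)=1$ for every $u$ of non-maximal rank. $\ell_1(\Omega)$ is the Banach space of functions $f\colon\Omega\to\mathbb{R}$ with $\sum_{u}|f(u)|<\infty$. $M(\Omega_i)$ is the set of $\pi\in\ell_1(\Omega)$ that vanish outside $\Omega_i$, are nonnegative, and satisfy $\sum_{u\in\Omega_i}\pi(u)=1$. $U$ induces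 a linear operator on $\ell_1(\Omega)$ by $(U\pi)(v)=\sum_{u\in\Omega}U(u\rightarrow v)\pi(u)$, and $U^k$ denotes its $k$th iterate. A sequence $(\pi_i\in M(\Omega_i))_{i\in I}$ is a $U$-sequence if $U\pi_i=\pi_{i+1}$ for every non-maximal $i\in I$. *)

theory Defs
  imports "HOL-Analysis.Infinite_Sum"
begin

definition int_interval :: "int set \<Rightarrow> bool" where
  "int_interval I \<longleftrightarrow> I \<noteq> {} \<and> (\<forall>a\<in>I. \<forall>b\<in>I. {a..b} \<subseteq> I)"

definition strictly_below :: "('a \<times> 'a) set \<Rightarrow> 'a \<Rightarrow> 'a \<Rightarrow> bool" where
  "strictly_below r u v \<longleftrightarrow> (u, v) \<in> r \<and> u \<noteq> v"

text \<open>The order relation is contained in the product of the carrier with itself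
  (this is part of \<^const>\<open>partial_order_on\<close>), so the intermediate element
  below need not be restricted to the carrier.\<close>

definition covered_by :: "('a \<times> 'a) set \<Rightarrow> 'a \<Rightarrow> 'a \<Rightarrow> bool" where
  "covered_by r u v \<longleftrightarrow>
     strictly_below r u v \<and> \<not> (\<exists>w. strictly_below r u w \<and> strictly_below r w v)"

locale graded_poset =
  fixes I :: "int set"
    and \<Omega> :: "'a set"
    and r :: "('a \<times> 'a) set"
    and \<rho> :: "'a \<Rightarrow> int"
  assumes interval: "int_interval I"
    and countable: "countable \<Omega>"
    and partial_order: "partial_order_on \<Omega> r"
    and rank_surj: "\<rho> ` \<Omega> = I"
    and rank_strict_mono: "strictly_below r u v \<Longrightarrow> \<rho> u < \<rho> v"
    and rank_cover: "covered_by r u v \<Longrightarrow> \<rho> v = \<rho> u + 1"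

definition level :: "'a set \<Rightarrow> ('a \<Rightarrow> int) \<Rightarrow> int \<Rightarrow> 'a set" where
  "level \<Omega> \<rho> i = {u \<in> \<Omega>. \<rho> u = i}"

definition non_maximal :: "int set \<Rightarrow> int \<Rightarrow> bool" where
  "non_maximal I i \<longleftrightarrow> i \<in> I \<and> (\<exists>j\<in>I. i < j)"

locale up_rule = graded_poset I \<Omega> r \<rho>
  for I :: "int set" and \<Omega> :: "'a set" and r :: "('a \<times> 'a) set" and \<rho> :: "'a \<Rightarrow> int" +
  fixes U :: "'a \<Rightarrow> 'a \<Rightarrow> real"
  assumes prob: "\<lbrakk>u \<in> \<Omega>; v \<in> \<Omega>\<rbrakk> \<Longrightarrow> U u v \<in> {0..1}"
    and pos_iff: "\<lbrakk>u \<in> \<Omega>; v \<in> \<Omega>\<rbrakk> \<Longrightarrow> U u v > 0 \<longleftrightarrow> covered_by r u v"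
    and total: "\<lbrakk>u \<in> \<Omega>; non_maximal I (\<rho> u)\<rbrakk> \<Longrightarrow> ((\<lambda>v. U u v) has_sum 1) \<Omega>"

text \<open>Functions on the carrier are represented by functions on the whole type that
  vanish outside the carrier, so that equality of functions is HOL equality.\<close>

definition ell1 :: "'a set \<Rightarrow> ('a \<Rightarrow> real) set" where
  "ell1 \<Omega> = {f. (\<forall>u. u \<notin> \<Omega> \<longrightarrow> f u = 0) \<and> f abs_summable_on \<Omega>}"

definition distributions :: "'a set \<Rightarrow> ('a \<Rightarrow> int) \<Rightarrow> int \<Rightarrow> ('a \<Rightarrow> real) set" where
  "distributions \<Omega> \<rho> i =
     {p \<in> ell1 \<Omega>. (\<forall>u. u \<notin> level \<Omega> \<rho> i \<longrightarrow> p u = 0) \<and> (\<forall>u. 0 \<le> p u) \<and>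
        (p has_sum 1) (level \<Omega> \<rho> i)}"

definition up_op :: "'a set \<Rightarrow> ('a \<Rightarrow> 'a \<Rightarrow> real) \<Rightarrow> ('a \<Rightarrow> real) \<Rightarrow> 'a \<Rightarrow> real" where
  "up_op \<Omega> U p = (\<lambda>v. if v \<in> \<Omega> then \<Sum>\<^sub>\<infinity>u\<in>\<Omega>. U u v * p u else 0)"

definition U_sequence ::
  "'a set \<Rightarrow> ('a \<Rightarrow> int) \<Rightarrow> ('a \<Rightarrow> 'a \<Rightarrow> real) \<Rightarrow> int set \<Rightarrow> (int \<Rightarrow> 'a \<Rightarrow> real) \<Rightarrow> bool" where
  "U_sequence \<Omega> \<rho> U J \<pi> \<longleftrightarrow>
     (\<forall>i\<in>J. \<pi> i \<in> distributions \<Omega> \<rho> i) \<and>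
     (\<forall>i. non_maximal J i \<longrightarrow> up_op \<Omega> U (\<pi> i) = \<pi> (i + 1))"

definition positive_sequence ::
  "'a set \<Rightarrow> ('a \<Rightarrow> int) \<Rightarrow> int set \<Rightarrow> (int \<Rightarrow> 'a \<Rightarrow> real) \<Rightarrow> bool" where
  "positive_sequence \<Omega> \<rho> J \<pi> \<longleftrightarrow> (\<forall>i\<in>J. \<forall>u\<in>level \<Omega> \<rho> i. 0 < \<pi> i u)"

end

theory Submission
  imports Defs "HOL-Analysis.Function_Topology"
begin

text \<open>
  When the levels are finite, the distributions on a level form a compact convex set, and pushing
  up by \<open>U\<close> is a continuous affine map from each of these sets to the next. A \<open>U\<close>-sequence
  is thus a point of an inverse limit of compact sets, and going up costs nothing: a distribution
  on a level determines everything above it. The only question is how to start from arbitrarily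
  low levels.

  A distribution on a level \<open>m\<close>, pushed up, satisfies the recursion from \<open>m\<close> on. By Tychonoff's
  theorem and the finite intersection property, such partial solutions for ever lower \<open>m\<close>
  accumulate at a maximal \<open>U\<close>-sequence. A closed constraint on a single fixed level \<open>n\<close>
  survives the limit: if for every \<open>m \<le> n\<close> some distribution on level \<open>m\<close> arrives on level \<open>n\<close>
  above a given function \<open>c\<close>, then some maximal \<open>U\<close>-sequence is above \<open>c\<close> on level \<open>n\<close>
  (lemma \<open>U_sequence_with_lower_bound\<close>). With \<open>c = 0\<close> this gives existence.

  For positivity, the hypothesis bounds the distribution \<open>\<pi>\<^sub>m\<^sub>,\<^sub>n\<close> from below on level
  \<open>n\<close> only, and this distribution depends on \<open>n\<close>, so the limit argument is applied to each \<open>n\<close>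
  separately, with \<open>c = b\<^sub>n\<close>. This gives countably many maximal \<open>U\<close>-sequences, the \<open>n\<close>-th one
  positive on level \<open>n\<close>. A convex combination of all of them with positive weights is again a
  \<open>U\<close>-sequence, and it is positive everywhere
  (lemma \<open>positive_U_sequence_if_positive_at_each_level\<close>). Conversely, a positive maximal
  \<open>U\<close>-sequence serves as its own family of bounds, since its member on level \<open>m\<close> is carried to
  its member on level \<open>n\<close>.
\<close>

section \<open>Compactness and evaluation in function spaces\<close>

lemma compact_box:
  fixes S :: "'i \<Rightarrow> 'b::topological_space set"
  assumes "\<And>i. compact (S i)"
  shows "compact {x. \<forall>i. x i \<in> S i}"
proof -
  have "compactin (product_topology (\<lambda>_. euclidean) UNIV) (PiE UNIV S)"
    using assms by (simp add: compactin_PiE)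
  moreover have "PiE UNIV S = {x. \<forall>i. x i \<in> S i}"
    by auto
  ultimately show ?thesis
    by (simp add: euclidean_product_topology)
qed

text \<open>The coordinate lemma has to be instantiated: left to unification, \<open>x i j\<close> can be read
  as a function of a dummy coordinate, and backward reasoning does not terminate.\<close>

lemma continuous_on_eval2:
  "continuous_on A (\<lambda>x :: 'i \<Rightarrow> 'j \<Rightarrow> 'b::topological_space. x i j)"
  using continuous_on_product_then_coordinatewise[where i = j,
      OF continuous_on_product_then_coordinatewise[where i = i, OF continuous_on_id]] .

section \<open>Up rules with finite levels\<close>

locale finite_level_up_rule = up_rule I \<Omega> r \<rho> U
  for I :: "int set" and \<Omega> :: "'a set" and r :: "('a \<times> 'a) set" and \<rho> :: "'a \<Rightarrow> int"
    and U :: "'a \<Rightarrow> 'a \<Rightarrow> real" +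
  assumes finite_level: "i \<in> I \<Longrightarrow> finite (level \<Omega> \<rho> i)"
begin

abbreviation L :: "int \<Rightarrow> 'a set" where "L \<equiv> level \<Omega> \<rho>"
abbreviation D :: "int \<Rightarrow> ('a \<Rightarrow> real) set" where "D \<equiv> distributions \<Omega> \<rho>"

lemma level_subset: "L i \<subseteq> \<Omega>"
  by (auto simp: level_def)

lemma mem_interval: "m \<in> I \<Longrightarrow> n \<in> I \<Longrightarrow> m \<le> i \<Longrightarrow> i \<le> n \<Longrightarrow> i \<in> I"
  using interval unfolding int_interval_def by (meson atLeastAtMost_iff subsetD)

lemma non_maximal_iff: "non_maximal I i \<longleftrightarrow> i \<in> I \<and> i + 1 \<in> I"
proof
  assume "non_maximal I i"
  then obtain j where "i \<in> I" "j \<in> I" "i < j"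
    by (auto simp: non_maximal_def)
  then show "i \<in> I \<and> i + 1 \<in> I"
    using mem_interval[of i j "i + 1"] by simp
qed (force simp: non_maximal_def)

lemma distributions_iff:
  assumes "i \<in> I"
  shows "p \<in> D i \<longleftrightarrow>
    (\<forall>u. u \<notin> L i \<longrightarrow> p u = 0) \<and> (\<forall>u. 0 \<le> p u) \<and> sum p (L i) = 1"
proof -
  have "p \<in> ell1 \<Omega>" if "\<forall>u. u \<notin> L i \<longrightarrow> p u = 0"
  proof -
    have "(\<lambda>u. norm (p u)) summable_on L i"
      by (simp add: finite_level[OF assms])
    moreover have "(\<lambda>u. norm (p u)) summable_on L i \<longleftrightarrow> (\<lambda>u. norm (p u)) summable_on \<Omega>"
      using level_subset that by (intro summable_on_cong_neutral) auto
    ultimately show ?thesis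
      using that level_subset by (auto simp: ell1_def)
  qed
  then show ?thesis
    using finite_level[OF assms] by (auto simp: distributions_def has_sum_finite_iff)
qed

lemma distributions_le_1:
  assumes "i \<in> I" "p \<in> D i"
  shows "p u \<le> 1"
proof (cases "u \<in> L i")
  case True
  then have "p u \<le> sum p (L i)"
    using assms by (intro member_le_sum) (auto simp: distributions_iff finite_level)
  then show ?thesis
    using assms by (simp add: distributions_iff)
qed (use assms in \<open>simp add: distributions_iff\<close>)

lemma distribution_exists:
  assumes "i \<in> I"
  shows "\<exists>p. p \<in> D i"
proof -
  obtain a where a: "a \<in> L i"
    using assms rank_surj by (auto simp: level_def)
  have "(\<lambda>u. if u = a then 1 else 0) \<in> D i"
    using a finite_level[OF assms] by (auto simp: distributions_iff[OF assms])
  then show ?thesis by blast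
qed

text \<open>Covering raises the rank by exactly one, so all of the mass leaving level \<open>i\<close> arrives on
  level \<open>i + 1\<close>. Every sum over \<open>\<Omega>\<close> thereby reduces to a finite sum over one level.\<close>

lemma rule_zero_off_next_level:
  assumes "u \<in> L i" "v \<in> \<Omega>" "v \<notin> L (i + 1)"
  shows "U u v = 0"
proof -
  have u: "u \<in> \<Omega>" "\<rho> u = i"
    using assms(1) by (auto simp: level_def)
  then have "\<not> covered_by r u v"
    using assms rank_cover by (auto simp: level_def)
  then show ?thesis
    using pos_iff[of u v] prob[of u v] u assms(2) by (auto simp: not_less)
qed

lemma rule_sum_next_level:
  assumes "non_maximal I i" "u \<in> L i"
  shows "(\<Sum>v\<in>L (i + 1). U u v) = 1"
proof -
  have fin: "finite (L (i + 1))"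
    using assms(1) finite_level by (auto simp: non_maximal_iff)
  have "((\<lambda>v. U u v) has_sum 1) \<Omega>"
    using assms by (intro total) (auto simp: level_def)
  moreover have "((\<lambda>v. U u v) has_sum 1) \<Omega> \<longleftrightarrow> ((\<lambda>v. U u v) has_sum 1) (L (i + 1))"
    using level_subset[of "i + 1"] rule_zero_off_next_level[OF assms(2)]
    by (intro has_sum_cong_neutral) auto
  ultimately show ?thesis
    using fin by (simp add: has_sum_finite_iff)
qed

lemma up_op_eq_sum:
  assumes "i \<in> I" "p \<in> D i"
  shows "up_op \<Omega> U p = (\<lambda>v. if v \<in> \<Omega> then \<Sum>u\<in>L i. U u v * p u else 0)"
proof -
  have "(\<Sum>\<^sub>\<infinity>u\<in>\<Omega>. U u v * p u) = (\<Sum>\<^sub>\<infinity>u\<in>L i. U u v * p u)" for v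
    using assms level_subset by (intro infsum_cong_neutral) (auto simp: distributions_iff)
  then show ?thesis
    using finite_level[OF assms(1)] by (simp add: up_op_def fun_eq_iff)
qed

lemma up_op_distribution:
  assumes "non_maximal I i" "p \<in> D i"
  shows "up_op \<Omega> U p \<in> D (i + 1)"
proof -
  have i: "i \<in> I" "i + 1 \<in> I"
    using assms(1) by (auto simp: non_maximal_iff)
  note up = up_op_eq_sum[OF i(1) assms(2)]
  have p: "sum p (L i) = 1" "\<And>u. 0 \<le> p u"
    using assms(2) by (auto simp: distributions_iff[OF i(1)])
  have "up_op \<Omega> U p v = 0" if "v \<notin> L (i + 1)" for v
    using that rule_zero_off_next_level[of _ i v] by (auto simp: up)
  moreover have "0 \<le> up_op \<Omega> U p v" for v
    using p(2) prob level_subset[of i] unfolding up by (auto intro!: sum_nonneg mult_nonneg_nonneg)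
  moreover have "sum (up_op \<Omega> U p) (L (i + 1)) = 1"
  proof -
    have "sum (up_op \<Omega> U p) (L (i + 1)) = (\<Sum>v\<in>L (i + 1). \<Sum>u\<in>L i. U u v * p u)"
      using level_subset[of "i + 1"] unfolding up by (intro sum.cong) auto
    also have "\<dots> = (\<Sum>u\<in>L i. (\<Sum>v\<in>L (i + 1). U u v) * p u)"
      by (subst sum.swap) (simp add: sum_distrib_right)
    also have "\<dots> = 1"
      using p(1) rule_sum_next_level[OF assms(1)] by simp
    finally show ?thesis .
  qed
  ultimately show ?thesis
    by (auto simp: distributions_iff[OF i(2)])
qed

lemma up_op_iterate_distribution:
  assumes "m \<in> I" "p \<in> D m" "m + int k \<in> I"
  shows "(up_op \<Omega> U ^^ k) p \<in> D (m + int k)"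
  using assms(3)
proof (induction k)
  case 0
  then show ?case using assms(2) by simp
next
  case (Suc k)
  have "m + int k \<in> I"
    using mem_interval[OF assms(1) Suc.prems] by simp
  moreover from this have "non_maximal I (m + int k)"
    using Suc.prems by (simp add: non_maximal_iff add_ac)
  ultimately show ?case
    using up_op_distribution[of "m + int k"] Suc.IH by (simp add: add_ac)
qed

lemma U_sequence_iterate:
  assumes "U_sequence \<Omega> \<rho> U I \<pi>" "m \<in> I" "m + int k \<in> I"
  shows "(up_op \<Omega> U ^^ k) (\<pi> m) = \<pi> (m + int k)"
  using assms(3)
proof (induction k)
  case (Suc k)
  have "m + int k \<in> I"
    using mem_interval[OF assms(2) Suc.prems] by simp
  moreover from this have "non_maximal I (m + int k)"
    using Suc.prems by (simp add: non_maximal_iff add_ac)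
  ultimately show ?case
    using Suc.IH assms(1) by (simp add: U_sequence_def add_ac)
qed simp

section \<open>Limits of partial sequences\<close>

text \<open>The recursion at a single index is a closed condition on sequences, and the sequences of
  distributions with the prescribed bound on level \<open>n\<close> form a compact set. Finitely many
  indices can be handled together by starting from a level below all of them, so compactness
  handles all indices at once.\<close>

lemma U_sequence_with_lower_bound:
  assumes n: "n \<in> I"
    and approx: "\<And>m. m \<in> I \<Longrightarrow> m \<le> n \<Longrightarrow>
      \<exists>p\<in>D m. \<forall>v\<in>L n. c v \<le> (up_op \<Omega> U ^^ nat (n - m)) p v"
  shows "\<exists>\<pi>. U_sequence \<Omega> \<rho> U I \<pi> \<and> (\<forall>v\<in>L n. c v \<le> \<pi> n v)"
proof -
  \<comment> \<open>\<open>B \<inter> A\<close> consists of the sequences of distributions that obey the bound on level \<open>n\<close>; the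
    box \<open>B\<close> supplies compactness and nonnegativity, and it bounds the coordinates that carry
    no meaning as well. \<open>E i\<close> is the recursion at \<open>i\<close>, written with a finite sum so that
    it is visibly closed.\<close>
  define B :: "(int \<Rightarrow> 'a \<Rightarrow> real) set" where "B = {x. \<forall>i. x i \<in> {q. \<forall>u. q u \<in> {0..1}}}"
  define A :: "(int \<Rightarrow> 'a \<Rightarrow> real) set" where
    "A = {x. (\<forall>i u. i \<in> I \<and> u \<notin> L i \<longrightarrow> x i u = 0) \<and>
             (\<forall>i. i \<in> I \<longrightarrow> sum (x i) (L i) = 1) \<and>
             (\<forall>v. v \<in> L n \<longrightarrow> c v \<le> x n v)}"
  define E :: "int \<Rightarrow> (int \<Rightarrow> 'a \<Rightarrow> real) set" where
    "E i = {x. \<forall>v. v \<in> \<Omega> \<longrightarrow> (\<Sum>u\<in>L i. U u v * x i u) = x (i + 1) v}" for i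
  have sum_cont: "continuous_on UNIV (\<lambda>x. \<Sum>u\<in>S. a u * x i u)"
    for S :: "'a set" and a :: "'a \<Rightarrow> real" and i :: int
    by (intro continuous_on_sum continuous_on_mult_left continuous_on_eval2)
  have "compact B"
    unfolding B_def by (intro compact_box) simp
  moreover have "closed A"
  proof -
    have "closed {x :: int \<Rightarrow> 'a \<Rightarrow> real. i \<in> I \<and> u \<notin> L i \<longrightarrow> x i u = 0}" for i u
      by (intro closed_Collect_imp open_Collect_const closed_Collect_eq continuous_on_eval2
          continuous_on_const)
    moreover have "closed {x :: int \<Rightarrow> 'a \<Rightarrow> real. i \<in> I \<longrightarrow> sum (x i) (L i) = 1}" for i
      using sum_cont[where S = "L i" and a = "\<lambda>_. 1" and i = i]
      by (intro closed_Collect_imp open_Collect_const closed_Collect_eq continuous_on_const) simp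
    moreover have "closed {x. v \<in> L n \<longrightarrow> c v \<le> x n v}" for v
      by (intro closed_Collect_imp open_Collect_const closed_Collect_le continuous_on_eval2
          continuous_on_const)
    ultimately show ?thesis
      unfolding A_def by (intro closed_Collect_conj closed_Collect_all)
  qed
  ultimately have compact: "compact (B \<inter> A)"
    by (rule compact_Int_closed)
  have closed: "closed (E i)" for i
    unfolding E_def
    by (intro closed_Collect_all closed_Collect_imp open_Collect_const closed_Collect_eq
        continuous_on_eval2 sum_cont)
  have distI: "x i \<in> D i" if "x \<in> B \<inter> A" "i \<in> I" for x i
    using that unfolding distributions_iff[OF that(2)] A_def B_def by simp
  have fip: "B \<inter> A \<inter> (\<Inter>i\<in>F. E i) \<noteq> {}"
    if F: "finite F" "F \<subseteq> {i. non_maximal I i}" for F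
  proof -
    \<comment> \<open>Including \<open>n\<close> guarantees \<open>m \<le> n\<close>, as the approximation hypothesis requires, and covers
      the case of empty \<open>F\<close>.\<close>
    define m where "m = Min (insert n F)"
    have "m \<in> insert n F"
      unfolding m_def using F(1) by (intro Min_in) auto
    then have mI: "m \<in> I"
      using F(2) n by (auto simp: non_maximal_def)
    have m_le: "m \<le> i" if "i \<in> insert n F" for i
      unfolding m_def using that F(1) by (intro Min_le) simp_all
    then have mn: "m \<le> n" by simp
    obtain p where p: "p \<in> D m" "\<forall>v\<in>L n. c v \<le> (up_op \<Omega> U ^^ nat (n - m)) p v"
      using approx[OF mI mn] by (elim bexE)
    obtain d where d: "\<And>i. i \<in> I \<Longrightarrow> d i \<in> D i"
      using distribution_exists by metis
    \<comment> \<open>The levels below \<open>m\<close> are not involved in the recursions indexed by \<open>F\<close>, so any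
      distributions will do there.\<close>
    define x where "x i = (if i \<notin> I then (\<lambda>_. 0) else if i < m then d i
        else (up_op \<Omega> U ^^ nat (i - m)) p)" for i
    have xD: "x i \<in> D i" if "i \<in> I" for i
      using up_op_iterate_distribution[OF mI p(1), of "nat (i - m)"] d[OF that] that
      by (auto simp: x_def)
    have "x i u \<in> {0..1}" for i u
    proof (cases "i \<in> I")
      case True
      then show ?thesis
        using distributions_le_1[OF True xD[OF True]] xD[OF True]
        by (simp add: distributions_iff[OF True])
    qed (simp add: x_def)
    then have "x \<in> B"
      by (simp add: B_def)
    moreover have "x \<in> A"
    proof -
      have "x n = (up_op \<Omega> U ^^ nat (n - m)) p"
        using n mn by (simp add: x_def)
      then have "\<forall>v. v \<in> L n \<longrightarrow> c v \<le> x n v"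
        using p(2) by simp
      moreover have "x i u = 0" if "i \<in> I" "u \<notin> L i" for i u
        using xD[OF that(1)] that(2) by (simp add: distributions_iff[OF that(1)])
      moreover have "sum (x i) (L i) = 1" if "i \<in> I" for i
        using xD[OF that] by (simp add: distributions_iff[OF that])
      ultimately show ?thesis by (simp add: A_def)
    qed
    moreover have "x \<in> E i" if iF: "i \<in> F" for i
    proof -
      have i: "i \<in> I" "i + 1 \<in> I"
        using iF F(2) by (auto simp: non_maximal_iff)
      have mi: "m \<le> i"
        using m_le iF by simp
      then have "nat (i + 1 - m) = Suc (nat (i - m))" by simp
      then have "x (i + 1) = up_op \<Omega> U (x i)"
        using i mi by (simp add: x_def)
      then show ?thesis
        using up_op_eq_sum[OF i(1) xD[OF i(1)]] by (simp add: E_def)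
    qed
    ultimately have "x \<in> B \<inter> A \<inter> (\<Inter>i\<in>F. E i)" by simp
    then show ?thesis by (metis empty_iff)
  qed
  have "B \<inter> A \<inter> (\<Inter>i\<in>{i. non_maximal I i}. E i) \<noteq> {}"
    by (rule compact_imp_fip_image[OF compact closed fip])
  then obtain x where "x \<in> B \<inter> A \<inter> (\<Inter>i\<in>{i. non_maximal I i}. E i)"
    by (metis ex_in_conv)
  then have xBA: "x \<in> B \<inter> A" and xE: "\<And>i. non_maximal I i \<Longrightarrow> x \<in> E i"
    by simp_all
  have "up_op \<Omega> U (x i) = x (i + 1)" if i: "non_maximal I i" for i
  proof
    fix v
    have iI: "i \<in> I" "i + 1 \<in> I"
      using i by (simp_all add: non_maximal_iff)
    have "x (i + 1) v = 0" if "v \<notin> \<Omega>"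
      using distI[OF xBA iI(2)] level_subset[of "i + 1"] that
      by (auto simp: distributions_iff[OF iI(2)])
    then show "up_op \<Omega> U (x i) v = x (i + 1) v"
      using xE[OF i] by (simp add: up_op_eq_sum[OF iI(1) distI[OF xBA iI(1)]] E_def)
  qed
  then have "U_sequence \<Omega> \<rho> U I x"
    using distI[OF xBA] by (simp add: U_sequence_def)
  moreover have "\<forall>v\<in>L n. c v \<le> x n v"
    using xBA by (simp add: A_def)
  ultimately show ?thesis by (intro exI conjI)
qed

lemma U_sequence_exists: "\<exists>\<pi>. U_sequence \<Omega> \<rho> U I \<pi>"
proof -
  obtain n where n: "n \<in> I"
    using interval by (auto simp: int_interval_def)
  have "\<exists>p\<in>D m. \<forall>v\<in>L n. 0 \<le> (up_op \<Omega> U ^^ nat (n - m)) p v" if m: "m \<in> I" "m \<le> n" for m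
  proof -
    obtain p where p: "p \<in> D m"
      using distribution_exists m by blast
    have "(up_op \<Omega> U ^^ nat (n - m)) p \<in> D n"
      using up_op_iterate_distribution[OF m(1) p, of "nat (n - m)"] n m by simp
    then show ?thesis
      using p by (auto simp: distributions_iff[OF n])
  qed
  then have "\<exists>\<pi>. U_sequence \<Omega> \<rho> U I \<pi> \<and> (\<forall>v\<in>L n. 0 \<le> \<pi> n v)"
    by (rule U_sequence_with_lower_bound[OF n])
  then show ?thesis by blast
qed

section \<open>Countable mixtures\<close>

text \<open>Levels are finite, so both the normalization of a distribution and the action of \<open>U\<close> are
  finite sums; these commute with the convergent series over the weights.\<close>

lemma U_sequence_mixture:
  fixes w :: "nat \<Rightarrow> real"
  assumes w: "\<And>j. 0 \<le> w j" "w sums 1"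
    and \<pi>: "\<And>j. U_sequence \<Omega> \<rho> U I (\<pi> j)"
  shows "U_sequence \<Omega> \<rho> U I (\<lambda>i u. \<Sum>j. w j * \<pi> j i u)"
    and "i \<in> I \<Longrightarrow> summable (\<lambda>j. w j * \<pi> j i u)"
proof -
  have D: "\<pi> j i \<in> D i" if "i \<in> I" for i j
    using \<pi>[of j] that by (simp add: U_sequence_def)
  have bounds: "0 \<le> \<pi> j i u" "\<pi> j i u \<le> 1" if "i \<in> I" for i j u
    using D[OF that] distributions_le_1[OF that] that by (auto simp: distributions_iff)
  show summ: "summable (\<lambda>j. w j * \<pi> j i u)" if i: "i \<in> I" for i u
  proof (rule summable_comparison_test')
    show "summable w"
      using w(2) by (simp add: sums_iff)
    show "norm (w j * \<pi> j i u) \<le> w j" for j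
      using w(1)[of j] bounds[OF i, where j = j and u = u] by (simp add: mult_left_le)
  qed
  have mixD: "(\<lambda>u. \<Sum>j. w j * \<pi> j i u) \<in> D i" if i: "i \<in> I" for i
  proof -
    have "(\<Sum>u\<in>L i. \<Sum>j. w j * \<pi> j i u) = (\<Sum>j. \<Sum>u\<in>L i. w j * \<pi> j i u)"
      by (intro suminf_sum[symmetric] summ i)
    also have "\<dots> = (\<Sum>j. w j)"
      using D[OF i] by (simp add: sum_distrib_left[symmetric] distributions_iff[OF i])
    finally have "(\<Sum>u\<in>L i. \<Sum>j. w j * \<pi> j i u) = 1"
      using w(2) by (simp add: sums_iff)
    moreover have "0 \<le> (\<Sum>j. w j * \<pi> j i u)" for u
      using summ[OF i] w(1) bounds(1)[OF i] by (intro suminf_nonneg) auto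
    ultimately show ?thesis
      using D[OF i] by (simp add: distributions_iff[OF i])
  qed
  have "up_op \<Omega> U (\<lambda>u. \<Sum>j. w j * \<pi> j i u) = (\<lambda>v. \<Sum>j. w j * \<pi> j (i + 1) v)"
    if nm: "non_maximal I i" for i
  proof
    fix v
    have i: "i \<in> I" "i + 1 \<in> I"
      using nm by (auto simp: non_maximal_iff)
    have step: "\<pi> j (i + 1) v = (if v \<in> \<Omega> then \<Sum>u\<in>L i. U u v * \<pi> j i u else 0)" for j
      using \<pi>[of j] nm up_op_eq_sum[OF i(1) D[OF i(1)], of j] by (simp add: U_sequence_def)
    have "(\<Sum>u\<in>L i. U u v * (\<Sum>j. w j * \<pi> j i u)) = (\<Sum>u\<in>L i. \<Sum>j. U u v * (w j * \<pi> j i u))"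
      by (simp add: suminf_mult summ[OF i(1)])
    also have "\<dots> = (\<Sum>j. \<Sum>u\<in>L i. U u v * (w j * \<pi> j i u))"
      by (intro suminf_sum[symmetric] summable_mult summ i(1))
    finally show "up_op \<Omega> U (\<lambda>u. \<Sum>j. w j * \<pi> j i u) v = (\<Sum>j. w j * \<pi> j (i + 1) v)"
      unfolding up_op_eq_sum[OF i(1) mixD[OF i(1)]] step
      by (simp add: sum_distrib_left mult_ac)
  qed
  then show "U_sequence \<Omega> \<rho> U I (\<lambda>i u. \<Sum>j. w j * \<pi> j i u)"
    using mixD by (simp add: U_sequence_def)
qed

lemma positive_U_sequence_if_positive_at_each_level:
  assumes "\<And>n. n \<in> I \<Longrightarrow> \<exists>\<pi>. U_sequence \<Omega> \<rho> U I \<pi> \<and> (\<forall>v\<in>L n. 0 < \<pi> n v)"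
  shows "\<exists>\<pi>. U_sequence \<Omega> \<rho> U I \<pi> \<and> positive_sequence \<Omega> \<rho> I \<pi>"
proof -
  obtain \<sigma> where \<sigma>: "\<And>n. n \<in> I \<Longrightarrow> U_sequence \<Omega> \<rho> U I (\<sigma> n)"
      "\<And>n v. n \<in> I \<Longrightarrow> v \<in> L n \<Longrightarrow> 0 < \<sigma> n n v"
    using assms by metis
  \<comment> \<open>An enumeration of the index interval with repetitions when it is finite; repetitions do no
    harm, because only the positivity of the total weight of each level matters.\<close>
  define e where "e = from_nat_into I"
  define w :: "nat \<Rightarrow> real" where "w j = (1/2) ^ Suc j" for j
  have I: "I \<noteq> {}"
    using interval by (simp add: int_interval_def)
  have e: "e j \<in> I" for j
    unfolding e_def by (rule from_nat_into[OF I])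
  have w: "0 < w j" for j
    by (simp add: w_def)
  have w_sums: "w sums 1"
    using power_half_series by (simp add: w_def[abs_def])
  note mix = U_sequence_mixture[of w "\<lambda>j. \<sigma> (e j)", OF less_imp_le[OF w] w_sums \<sigma>(1)[OF e]]
  have "0 < (\<Sum>j. w j * \<sigma> (e j) i u)" if i: "i \<in> I" and u: "u \<in> L i" for i u
  proof -
    obtain k where k: "e k = i"
      using i from_nat_into_surj[of I i] unfolding e_def by auto
    have "\<sigma> (e j) i \<in> D i" for j
      using \<sigma>(1)[OF e] i by (simp add: U_sequence_def)
    then have "0 \<le> w j * \<sigma> (e j) i u" for j
      using less_imp_le[OF w] by (simp add: distributions_iff[OF i])
    moreover have "0 < w k * \<sigma> (e k) i u"
      using \<sigma>(2)[OF i u] w[of k] k by simp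
    ultimately show ?thesis
      using mix(2)[OF i] by (intro suminf_pos2)
  qed
  then show ?thesis
    using mix(1) by (auto simp: positive_sequence_def)
qed

end

theorem theorem6:
  fixes I :: "int set" and \<Omega> :: "'a set" and r :: "('a \<times> 'a) set"
    and \<rho> :: "'a \<Rightarrow> int" and U :: "'a \<Rightarrow> 'a \<Rightarrow> real"
  assumes "up_rule I \<Omega> r \<rho> U"
    and "\<forall>i\<in>I. finite (level \<Omega> \<rho> i)"
  shows "(\<exists>\<pi>. U_sequence \<Omega> \<rho> U I \<pi>) \<and>
    ((\<exists>\<pi>. U_sequence \<Omega> \<rho> U I \<pi> \<and> positive_sequence \<Omega> \<rho> I \<pi>) \<longleftrightarrow>
     (\<exists>b :: int \<Rightarrow> 'a \<Rightarrow> real.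
        positive_sequence \<Omega> \<rho> I b \<and>
        (\<forall>m\<in>I. \<forall>n\<in>I. m \<le> n \<longrightarrow>
           (\<exists>p\<in>distributions \<Omega> \<rho> m.
              \<forall>v\<in>level \<Omega> \<rho> n. b n v \<le> ((up_op \<Omega> U) ^^ nat (n - m)) p v))))"
    (is "_ \<and> (?positive \<longleftrightarrow> ?bounds)")
proof -
  interpret up_rule I \<Omega> r \<rho> U by fact
  interpret finite_level_up_rule I \<Omega> r \<rho> U
    using assms(2) by unfold_locales blast
  have "?bounds" if "?positive"
  proof -
    from that obtain \<pi> where \<pi>: "U_sequence \<Omega> \<rho> U I \<pi>" "positive_sequence \<Omega> \<rho> I \<pi>"
      by blast
    have "\<exists>p\<in>D m. \<forall>v\<in>L n. \<pi> n v \<le> (up_op \<Omega> U ^^ nat (n - m)) p v"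
      if "m \<in> I" "n \<in> I" "m \<le> n" for m n
      using U_sequence_iterate[OF \<pi>(1) that(1), of "nat (n - m)"] that \<pi>(1)
      by (intro bexI[of _ "\<pi> m"]) (auto simp: U_sequence_def)
    then show ?thesis
      using \<pi>(2) by blast
  qed
  moreover have "?positive" if "?bounds"
  proof (rule positive_U_sequence_if_positive_at_each_level)
    fix n
    assume n: "n \<in> I"
    from that obtain b where b: "positive_sequence \<Omega> \<rho> I b"
      and all: "\<forall>m\<in>I. \<forall>n\<in>I. m \<le> n \<longrightarrow>
        (\<exists>p\<in>D m. \<forall>v\<in>L n. b n v \<le> (up_op \<Omega> U ^^ nat (n - m)) p v)"
      by (elim exE conjE)
    have approx: "\<exists>p\<in>D m. \<forall>v\<in>L n. b n v \<le> (up_op \<Omega> U ^^ nat (n - m)) p v"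
      if "m \<in> I" "m \<le> n" for m
      using all that n by simp
    have "\<exists>\<pi>. U_sequence \<Omega> \<rho> U I \<pi> \<and> (\<forall>v\<in>L n. b n v \<le> \<pi> n v)"
      by (rule U_sequence_with_lower_bound[OF n approx])
    then obtain \<pi> where "U_sequence \<Omega> \<rho> U I \<pi>" "\<forall>v\<in>L n. b n v \<le> \<pi> n v"
      by blast
    then show "\<exists>\<pi>. U_sequence \<Omega> \<rho> U I \<pi> \<and> (\<forall>v\<in>L n. 0 < \<pi> n v)"
      using b n by (force simp: positive_sequence_def)
  qed
  ultimately show ?thesis
    using U_sequence_exists by (intro conjI iffI)
qed

end
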